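(* For each positive integer $v\equiv 0\pmod{12}$, there exists a $(K_{1,3},K_3)$-URD$\left(v;\frac{2(v-6)}{3},2\right)$ of $K_v-I$.
   Context: $K_v$ is the complete graph on $v$ vertices, and for $v$ even $K_v-I$ denotes $K_v$ with the edges of a 1-factor (perfect matching) $I$ removed. A 3-star is a copy of $K_{1,3}$ (4 vertices, one centre joined to three leaves); a 3-cycle is a copy of $K_3$. A decomposition of a graph $G$ into 3-stars and 3-cycles is a partition of the edge set of $G$ into edge sets of subgraphs (blocks), each isomorphic to $K_{1,3}$ or $K_3$. A class is a set of blocks of the decomposition such that every vertex of $G$ lies in exactly one of them. For $v$ even, a $(K_{1,3},K_3)$-URD$(v;r,s)$ of $K_v-I$ is a decomposition of $K_v-I$ into 3-stars and 3-cycles whose blocks can be partitioned into $r+s$ classes, of which $r$ classes consist only of 3-stars and $s$ classes consist only of 3-cycles. *)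

theory Defs
  imports "HOL-Library.Disjoint_Sets"
begin

text \<open>
  A finite simple graph is given by its vertex set and its set of edges, an edge being a
  two-element set of vertices. Since 3-stars and 3-cycles have no isolated vertices, a block
  is represented by its edge set \<open>B\<close>, and its vertex set is \<open>\<Union>B\<close>.
\<close>

definition complete_edges :: "'a set \<Rightarrow> 'a set set" where
  "complete_edges V = {{x, y} | x y. x \<in> V \<and> y \<in> V \<and> x \<noteq> y}"

definition one_factor :: "'a set \<Rightarrow> 'a set set \<Rightarrow> 'a set set \<Rightarrow> bool" where
  "one_factor V E I \<longleftrightarrow> I \<subseteq> E \<and> (\<forall>x\<in>V. \<exists>!e. e \<in> I \<and> x \<in> e)"

definition three_star :: "'a set set \<Rightarrow> bool" where
  "three_star B \<longleftrightarrow>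
     (\<exists>c x y z. distinct [c, x, y, z] \<and> B = {{c, x}, {c, y}, {c, z}})"

definition three_cycle :: "'a set set \<Rightarrow> bool" where
  "three_cycle B \<longleftrightarrow>
     (\<exists>x y z. distinct [x, y, z] \<and> B = {{x, y}, {y, z}, {z, x}})"

definition star_cycle_decomposition :: "'a set set \<Rightarrow> 'a set set set \<Rightarrow> bool" where
  "star_cycle_decomposition E D \<longleftrightarrow>
     partition_on E D \<and> (\<forall>B\<in>D. three_star B \<or> three_cycle B)"

definition block_class :: "'a set \<Rightarrow> 'a set set set \<Rightarrow> 'a set set set \<Rightarrow> bool" where
  "block_class V D C \<longleftrightarrow> C \<subseteq> D \<and> (\<forall>x\<in>V. \<exists>!B. B \<in> C \<and> x \<in> \<Union>B)"

text \<open>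
  \<open>P\<close> is the collection of star classes and \<open>Q\<close> the collection of cycle classes.
\<close>

definition star_cycle_URD ::
  "'a set \<Rightarrow> 'a set set \<Rightarrow> nat \<Rightarrow> nat \<Rightarrow> 'a set set set \<Rightarrow> bool" where
  "star_cycle_URD V E r s D \<longleftrightarrow>
     star_cycle_decomposition E D \<and>
     (\<exists>P Q. partition_on D (P \<union> Q) \<and> P \<inter> Q = {} \<and>
        finite P \<and> card P = r \<and> finite Q \<and> card Q = s \<and>
        (\<forall>C\<in>P \<union> Q. block_class V D C) \<and>
        (\<forall>C\<in>P. \<forall>B\<in>C. three_star B) \<and>
        (\<forall>C\<in>Q. \<forall>B\<in>C. three_cycle B))"

end

theory Submission
  imports Defs
begin

text \<open>
  Write \<open>v = 12 * n\<close> and arrange the vertices in \<open>n\<close> layers of \<open>12\<close> points, indexed by \<open>\<int>\<^sub>n\<close>, so that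
  every edge of the one-factor lies inside a layer. The graph then splits according to the cyclic
  distance \<open>d\<close> of the layers of the two ends, and each part is resolved separately.

  Inside the layers, an explicit resolution of \<open>K\<^sub>1\<^sub>2 - I\<close> into four star classes and two triangle
  classes is used in all layers simultaneously (\<open>lab12_once\<close>). These are all the triangles.

  For \<open>0 < 2 * d < n\<close> there are \<open>16\<close> star classes, all of whose stars have their centre in a layer
  \<open>x\<close> and their leaves in the layer \<open>x + d\<close>. The twelve points of a layer form four rows of three
  points. A class chooses a row of centres in each layer, and the other nine points of the layer are
  leaves. A star class using one and the same row in all layers can never cover an edge inside that
  row, so the row has to change along \<open>x, x + d, x + 2 * d, \<dots>\<close>. These cycles may be odd, but three
  colours suffice to colour them, and the three coordinates of an orthogonal array of strength two
  with \<open>16\<close> runs on four symbols say which row is used in layers of each colour. Consecutive layers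
  then see every pair of rows exactly once over the \<open>16\<close> classes, so that each pair of a centre row
  and a leaf row occurs in three classes. These share the three perfect matchings (cyclic
  rotations) between the two rows (\<open>lab_step_once\<close>).

  If \<open>n = 2 * d\<close>, the distance \<open>d\<close> pairs the layers, and each pair spans a \<open>K\<^sub>1\<^sub>2\<^sub>,\<^sub>1\<^sub>2\<close>, which is
  resolved into eight star classes by a cyclic construction (\<open>lab24_once\<close>).

  Altogether there are \<open>8 * n - 4\<close> star classes and two triangle classes. A class is encoded by a map
  sending each vertex to a label of its block, namely the centre for a star; the required conditions
  are then that fibres have the right size and that each edge belongs to exactly one class
  (\<open>URD_from_labellings\<close>).
\<close>

section \<open>Classes as vertex labellings\<close>

definition fibre :: "'a set \<Rightarrow> ('a \<Rightarrow> 'a) \<Rightarrow> 'a \<Rightarrow> 'a set" where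
  "fibre V f z = {y \<in> V. f y = z}"

text \<open>
  For a star class the label of a vertex is the centre of its star, so an edge joins a vertex to
  its label. For a cycle class the label only names the triangle, and all pairs with equal labels
  are edges.
\<close>

definition adj :: "bool \<Rightarrow> ('a \<Rightarrow> 'a) \<Rightarrow> 'a \<Rightarrow> 'a \<Rightarrow> bool" where
  "adj star f x y \<longleftrightarrow> (if star then f x = y \<or> f y = x else f x = f y)"

lemma adj_sym: "adj s f x y \<longleftrightarrow> adj s f y x"
  by (auto simp: adj_def)

definition fibre_edges :: "bool \<Rightarrow> 'a set \<Rightarrow> ('a \<Rightarrow> 'a) \<Rightarrow> 'a \<Rightarrow> 'a set set" where
  "fibre_edges star V f z =
     {{x, y} | x y. x \<in> fibre V f z \<and> y \<in> fibre V f z \<and> x \<noteq> y \<and> adj star f x y}"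

text \<open>
  Fibres over values of a star labelling have \<open>4\<close> points, the centre being one of them because
  the map is idempotent. The label of a triangle need not lie in the triangle.
\<close>

definition labelling :: "bool \<Rightarrow> 'a set \<Rightarrow> ('a \<Rightarrow> 'a) \<Rightarrow> bool" where
  "labelling star V f \<longleftrightarrow>
     (\<forall>x\<in>V. f x \<in> V \<and> (star \<longrightarrow> f (f x) = f x) \<and> card (fibre V f (f x)) = (if star then 4 else 3))"

lemma star_block:
  assumes f: "labelling True V f" and x: "x \<in> V"
  shows "three_star (fibre_edges True V f (f x))"
    and "\<Union>(fibre_edges True V f (f x)) = fibre V f (f x)"
proof -
  let ?F = "fibre V f (f x)"
  have c: "f x \<in> ?F" and F4: "card ?F = 4"
    using f x by (auto simp: labelling_def fibre_def)
  have "card (?F - {f x}) = 3"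
    using c F4 by simp
  then obtain p q r where pqr: "?F - {f x} = {p, q, r}" "p \<noteq> q" "q \<noteq> r" "p \<noteq> r"
    by (auto simp: card_3_iff)
  have d: "distinct [f x, p, q, r]"
    using pqr by auto
  have F: "?F = {f x, p, q, r}"
    using c pqr(1) by blast
  have lab: "f y = f x" if "y \<in> ?F" for y
    using that by (simp add: fibre_def)
  have "f (f x) = f x" "f p = f x" "f q = f x" "f r = f x"
    using lab F by auto
  then have B: "fibre_edges True V f (f x) = {{f x, p}, {f x, q}, {f x, r}}"
    unfolding fibre_edges_def adj_def F using d
    by (auto simp: insert_commute)
  show "three_star (fibre_edges True V f (f x))"
    unfolding three_star_def B using d by blast
  show "\<Union>(fibre_edges True V f (f x)) = ?F"
    unfolding B F by auto
qed

lemma cycle_block: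
  assumes f: "labelling False V f" and x: "x \<in> V"
  shows "three_cycle (fibre_edges False V f (f x))"
    and "\<Union>(fibre_edges False V f (f x)) = fibre V f (f x)"
proof -
  let ?F = "fibre V f (f x)"
  have "card ?F = 3"
    using f x by (auto simp: labelling_def)
  then obtain p q r where F: "?F = {p, q, r}" and d: "p \<noteq> q" "q \<noteq> r" "p \<noteq> r"
    by (auto simp: card_3_iff)
  have "f y = f x" if "y \<in> ?F" for y
    using that by (simp add: fibre_def)
  then have "f p = f x" "f q = f x" "f r = f x"
    using F by auto
  then have B: "fibre_edges False V f (f x) = {{p, q}, {q, r}, {r, p}}"
    unfolding fibre_edges_def adj_def F using d
    by (auto simp: insert_commute) (metis insert_commute)+
  show "three_cycle (fibre_edges False V f (f x))"
    unfolding three_cycle_def B using d by force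
  show "\<Union>(fibre_edges False V f (f x)) = ?F"
    unfolding B F by auto
qed

text \<open>
  Two blocks sharing an edge must come from the same class, by uniqueness in the assumption
  \<open>once\<close>, and then from the same fibre. So all disjointness statements about blocks and about
  classes reduce to the fact that each edge outside \<open>I\<close> has exactly one class.
\<close>

lemma URD_from_labellings:
  fixes lab :: "'k \<Rightarrow> 'a \<Rightarrow> 'a"
  assumes fin: "finite K" "finite T" and disj: "K \<inter> T = {}" and ne: "V \<noteq> {}"
    and lab: "\<And>k. k \<in> K \<union> T \<Longrightarrow> labelling (k \<in> K) V (lab k)"
    and once: "\<And>x y. \<lbrakk>x \<in> V; y \<in> V; x \<noteq> y; {x, y} \<notin> I\<rbrakk> \<Longrightarrow>
                 \<exists>!k. k \<in> K \<union> T \<and> adj (k \<in> K) (lab k) x y"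
    and never: "\<And>x y k. \<lbrakk>x \<in> V; y \<in> V; x \<noteq> y; {x, y} \<in> I; k \<in> K \<union> T\<rbrakk> \<Longrightarrow>
                 \<not> adj (k \<in> K) (lab k) x y"
  shows "\<exists>D. star_cycle_URD V (complete_edges V - I) (card K) (card T) D"
proof -
  define B where "B k x = fibre_edges (k \<in> K) V (lab k) (lab k x)" for k x
  define C where "C k = B k ` V" for k
  define D where "D = (\<Union>k\<in>K \<union> T. C k)"
  let ?E = "complete_edges V - I"
  have star: "three_star (B k x)" if "k \<in> K" "x \<in> V" for k x
    using star_block(1)[of V "lab k" x] lab[of k] that by (simp add: B_def)
  have cycle: "three_cycle (B k x)" if "k \<in> T" "x \<in> V" for k x
  proof -
    have "k \<notin> K"
      using disj \<open>k \<in> T\<close> by blast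
    then show ?thesis
      using cycle_block(1)[of V "lab k" x] lab[of k] that by (simp add: B_def)
  qed
  have UB: "\<Union>(B k x) = fibre V (lab k) (lab k x)" if "k \<in> K \<union> T" "x \<in> V" for k x
    using star_block(2)[of V "lab k" x] cycle_block(2)[of V "lab k" x] lab[of k] that
    by (cases "k \<in> K") (simp_all add: B_def)
  have neB: "B k x \<noteq> {}" if "k \<in> K \<union> T" "x \<in> V" for k x
    using UB[OF that] that by (force simp: fibre_def)
  have inB: "\<exists>x y. e = {x, y} \<and> x \<in> V \<and> y \<in> V \<and> x \<noteq> y \<and> adj (k \<in> K) (lab k) x y
      \<and> lab k x = lab k z \<and> lab k y = lab k z" if "e \<in> B k z" for e k z
    using that by (auto simp: B_def fibre_edges_def fibre_def)
  have adj_lab: "lab k x = lab k y"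
    if "adj (k \<in> K) (lab k) x y" "k \<in> K \<union> T" "x \<in> V" "y \<in> V" for k x y
    using that lab[of k] by (auto simp: adj_def labelling_def split: if_splits)
  have same: "k = k' \<and> B k z = B k' z'"
    if "e \<in> B k z" "e \<in> B k' z'" "k \<in> K \<union> T" "k' \<in> K \<union> T" for e k z k' z'
  proof -
    obtain x y where xy: "e = {x, y}" "x \<in> V" "y \<in> V" "x \<noteq> y" "adj (k \<in> K) (lab k) x y"
        "lab k x = lab k z"
      using inB[OF \<open>e \<in> B k z\<close>] by blast
    obtain x' y' where x'y': "e = {x', y'}" "adj (k' \<in> K) (lab k') x' y'"
        "lab k' x' = lab k' z'" "lab k' y' = lab k' z'"
      using inB[OF \<open>e \<in> B k' z'\<close>] by blast
    have adj': "adj (k' \<in> K) (lab k') x y" "lab k' x = lab k' z'"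
      using x'y' xy(1) adj_sym[of "k' \<in> K" "lab k'" x' y'] by (auto simp: doubleton_eq_iff)
    have "{x, y} \<notin> I"
      using never xy that(3) by blast
    then have "k = k'"
      using once[OF xy(2,3,4)] xy(5) adj'(1) that(3,4) by blast
    then show ?thesis
      using adj'(2) xy(6) by (simp add: B_def)
  qed
  have E: "\<Union>D = ?E"
  proof
    show "\<Union>D \<subseteq> ?E"
    proof
      fix e assume "e \<in> \<Union>D"
      then obtain k z where "k \<in> K \<union> T" "e \<in> B k z"
        by (auto simp: D_def C_def)
      with inB[of e k z] never show "e \<in> ?E"
        unfolding complete_edges_def by blast
    qed
    show "?E \<subseteq> \<Union>D"
    proof
      fix e assume "e \<in> ?E"
      then obtain x y where xy: "e = {x, y}" "x \<in> V" "y \<in> V" "x \<noteq> y" "{x, y} \<notin> I"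
        by (auto simp: complete_edges_def)
      then obtain k where k: "k \<in> K \<union> T" "adj (k \<in> K) (lab k) x y"
        using once by blast
      have "e \<in> B k x"
        using xy k adj_lab[OF k(2,1) xy(2,3)] by (auto simp: B_def fibre_edges_def fibre_def)
      then show "e \<in> \<Union>D"
        using k xy by (auto simp: D_def C_def)
    qed
  qed
  have partE: "partition_on ?E D"
  proof (rule partition_onI)
    show "\<Union>D = ?E" by (rule E)
    show "disjnt p q" if pq: "p \<in> D" "q \<in> D" "p \<noteq> q" for p q
    proof (rule ccontr)
      assume "\<not> disjnt p q"
      moreover obtain k x k' x' where "p = B k x" "q = B k' x'" "k \<in> K \<union> T" "k' \<in> K \<union> T"
        using pq by (auto simp: D_def C_def)
      moreover from calculation obtain e where "e \<in> B k x" "e \<in> B k' x'"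
        unfolding disjnt_def by blast
      ultimately show False
        using same[of e k x k' x'] \<open>p \<noteq> q\<close> by metis
    qed
    show "{} \<notin> D"
      using neB by (auto simp: D_def C_def image_iff)
  qed
  have Cdisj: "C k \<inter> C k' = {}" if kk: "k \<in> K \<union> T" "k' \<in> K \<union> T" "k \<noteq> k'" for k k'
  proof (rule ccontr)
    assume "C k \<inter> C k' \<noteq> {}"
    then obtain x x' where "B k x = B k' x'" "x \<in> V" "x' \<in> V"
      by (auto simp: C_def)
    moreover obtain e where "e \<in> B k x"
      using neB[OF kk(1) \<open>x \<in> V\<close>] by blast
    ultimately show False
      using same kk by metis
  qed
  have Cne: "C k \<noteq> {}" for k
    using ne by (simp add: C_def)
  have Cinj: "inj_on C (K \<union> T)"
    by (rule inj_onI) (metis Cdisj Cne Int_absorb)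
  have partD: "partition_on D (C ` K \<union> C ` T)"
  proof (rule partition_onI)
    show "\<Union>(C ` K \<union> C ` T) = D" by (auto simp: D_def)
    show "disjnt p q" if "p \<in> C ` K \<union> C ` T" "q \<in> C ` K \<union> C ` T" "p \<noteq> q" for p q
      using that Cdisj unfolding disjnt_def by blast
    show "{} \<notin> C ` K \<union> C ` T"
      using Cne by (metis UnE imageE)
  qed
  have cls: "block_class V D (C k)" if k: "k \<in> K \<union> T" for k
    unfolding block_class_def
  proof (intro conjI ballI)
    show "C k \<subseteq> D" using k by (auto simp: D_def)
    fix x assume x: "x \<in> V"
    show "\<exists>!b. b \<in> C k \<and> x \<in> \<Union>b"
    proof
      show "B k x \<in> C k \<and> x \<in> \<Union>(B k x)"
        using x UB[OF k x] by (simp add: C_def fibre_def)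
      fix b assume "b \<in> C k \<and> x \<in> \<Union>b"
      then obtain z where "z \<in> V" "b = B k z" "x \<in> \<Union>(B k z)" by (auto simp: C_def)
      then have "lab k x = lab k z"
        using UB[OF k \<open>z \<in> V\<close>] by (simp only: fibre_def mem_Collect_eq)
      then show "b = B k x"
        using \<open>b = B k z\<close> by (simp add: B_def)
    qed
  qed
  have "star_cycle_URD V ?E (card K) (card T) D"
    unfolding star_cycle_URD_def star_cycle_decomposition_def
  proof (intro conjI exI)
    show "partition_on ?E D" by (rule partE)
    show "\<forall>b\<in>D. three_star b \<or> three_cycle b"
      using star cycle by (auto simp: D_def C_def)
    show "partition_on D (C ` K \<union> C ` T)" by (rule partD)
    show "C ` K \<inter> C ` T = {}"
      using Cinj disj by (simp flip: inj_on_image_Int[OF Cinj])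
    show "card (C ` K) = card K" "card (C ` T) = card T"
      using Cinj by (auto simp: card_image inj_on_Un)
    show "\<forall>c\<in>C ` K \<union> C ` T. block_class V D c" using cls by blast
    show "\<forall>c\<in>C ` K. \<forall>b\<in>c. three_star b" using star by (auto simp: C_def)
    show "\<forall>c\<in>C ` T. \<forall>b\<in>c. three_cycle b" using cycle by (auto simp: C_def)
  qed (use fin in auto)
  then show ?thesis by blast
qed

section \<open>A resolution of one layer\<close>

text \<open>
  Cardinalities in small ranges are evaluated as lengths of filtered lists, on which rewriting
  with code equations runs well.
\<close>

lemma length_filter_upt: "length (filter P [0..<m]) = card {j. j < m \<and> P j}"
  by (subst distinct_card[symmetric]) (auto intro: arg_cong[of _ _ card])

lemma card_1_ex1:
  assumes "card {x. P x} = 1"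
  shows "\<exists>!x. P x"
proof -
  obtain x where "{x. P x} = {x}"
    using assms by (rule card_1_singletonE)
  then have "P y \<longleftrightarrow> y = x" for y
    by blast
  then show ?thesis
    by simp
qed

text \<open>
  Four star classes (rows \<open>0\<close> to \<open>3\<close>) and two triangle classes (rows \<open>4\<close> and \<open>5\<close>) that decompose
  \<open>K\<^sub>1\<^sub>2\<close> minus the pairs \<open>{i, i + 6}\<close>; column \<open>i\<close> holds the label of the point \<open>i\<close>. As each vertex
  has degree \<open>6\<close> in the star part, it is the centre of exactly one star; the table was found by a
  computer search under this restriction.
\<close>

definition lab12 :: "nat \<Rightarrow> nat \<Rightarrow> nat" where
  "lab12 j i =
     [[0, 9, 9, 10, 0, 10, 9, 0, 10, 9, 10, 0],
      [3, 8, 7, 3, 8, 3, 7, 7, 8, 8, 7, 3],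
      [2, 6, 2, 2, 5, 5, 6, 5, 6, 5, 6, 2],
      [1, 1, 4, 1, 4, 1, 11, 4, 11, 4, 11, 11],
      [0, 1, 1, 3, 3, 0, 3, 7, 0, 7, 1, 7],
      [0, 1, 2, 3, 1, 2, 2, 3, 3, 0, 0, 1]] ! j ! i"

lemma lab12_once:
  assumes "i < 12" "i' < 12" "i \<noteq> i'"
  shows "card {j. j < 6 \<and> adj (j < 4) (lab12 j) i i'} = (if i' = (i + 6) mod 12 then 0 else 1)"
proof -
  have "\<forall>i\<in>set [0..<12]. \<forall>i'\<in>set [0..<12]. i \<noteq> i' \<longrightarrow>
     length (filter (\<lambda>j. adj (j < 4) (lab12 j) i i') [0..<6]) = (if i' = (i + 6) mod 12 then 0 else 1)"
    by code_simp
  then show ?thesis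
    using assms by (simp add: length_filter_upt)
qed

lemma lab12_fibre:
  assumes "j < 6" "i < 12"
  shows "lab12 j i < 12" "j < 4 \<Longrightarrow> lab12 j (lab12 j i) = lab12 j i"
    "card {i'. i' < 12 \<and> lab12 j i' = lab12 j i} = (if j < 4 then 4 else 3)"
proof -
  have "\<forall>j\<in>set [0..<6]. \<forall>i\<in>set [0..<12].
     lab12 j i < 12 \<and> (j < 4 \<longrightarrow> lab12 j (lab12 j i) = lab12 j i) \<and>
     length (filter (\<lambda>i'. lab12 j i' = lab12 j i) [0..<12]) = (if j < 4 then 4 else 3)"
    by code_simp
  then show "lab12 j i < 12" "j < 4 \<Longrightarrow> lab12 j (lab12 j i) = lab12 j i"
    "card {i'. i' < 12 \<and> lab12 j i' = lab12 j i} = (if j < 4 then 4 else 3)"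
    using assms by (simp_all add: length_filter_upt)
qed

section \<open>Eight star classes of the balanced bipartite graph on 24 points\<close>

text \<open>
  The point \<open>w = 3 * g + q\<close> stands for \<open>(g, q) \<in> \<int>\<^sub>8 \<times> \<int>\<^sub>3\<close>, and its side is the parity of \<open>g\<close>. The
  list is one star class, and class \<open>j\<close> is its translate under \<open>g \<mapsto> g + j\<close>. The \<open>18\<close> edges of the
  base class represent the \<open>18\<close> orbits of cross edges under these translations, once each; that is
  why the eight translates decompose the graph.
\<close>

definition lab24 :: "nat \<Rightarrow> nat \<Rightarrow> nat" where
  "lab24 j w =
     ([0, 1, 22, 0, 1, 5, 15, 5, 8, 1, 0, 8, 5, 15, 22, 15, 1, 8, 22, 5, 15, 8, 22, 0]
       ! ((w + 24 - 3 * j) mod 24) + 3 * j) mod 24"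

lemma lab24_once:
  assumes "w < 24" "w' < 24" "w \<noteq> w'"
  shows "card {j. j < 8 \<and> adj True (lab24 j) w w'} =
           (if even (w div 3) = even (w' div 3) then 0 else 1)"
proof -
  have "\<forall>w\<in>set [0..<24]. \<forall>w'\<in>set [0..<24]. w \<noteq> w' \<longrightarrow>
     length (filter (\<lambda>j. adj True (lab24 j) w w') [0..<8]) =
     (if even (w div 3) = even (w' div 3) then 0 else 1)"
    by code_simp
  then show ?thesis
    using assms by (simp add: length_filter_upt)
qed

lemma lab24_fibre:
  assumes "j < 8" "w < 24"
  shows "lab24 j w < 24" "lab24 j (lab24 j w) = lab24 j w"
    "card {w'. w' < 24 \<and> lab24 j w' = lab24 j w} = 4"
proof -
  have "\<forall>j\<in>set [0..<8]. \<forall>w\<in>set [0..<24].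
     lab24 j w < 24 \<and> lab24 j (lab24 j w) = lab24 j w \<and>
     length (filter (\<lambda>w'. lab24 j w' = lab24 j w) [0..<24]) = 4"
    by code_simp
  then show "lab24 j w < 24" "lab24 j (lab24 j w) = lab24 j w"
    "card {w'. w' < 24 \<and> lab24 j w' = lab24 j w} = 4"
    using assms by (simp_all add: length_filter_upt)
qed

section \<open>Orthogonal centre rows and slots\<close>

text \<open>
  The indices \<open>j < 16\<close> are pairs \<open>(j div 4, j mod 4)\<close> over \<open>\<int>\<^sub>4\<close>; the colours \<open>0, 1, 2\<close> read off the
  first coordinate, the second one and their sum. Any two of these determine the pair, so the three
  functions are pairwise orthogonal.
\<close>

definition centre_row :: "nat \<Rightarrow> nat \<Rightarrow> nat" where
  "centre_row a j =
     (if a = 0 then j div 4 else if a = 1 then j mod 4 else (j div 4 + j mod 4) mod 4)"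

lemma centre_row_orthogonal:
  assumes "a < 3" "b < 3" "a \<noteq> b" "P < 4" "Q < 4"
  shows "\<exists>!j. j < 16 \<and> centre_row a j = P \<and> centre_row b j = Q"
proof -
  have "\<forall>a\<in>set [0..<3]. \<forall>b\<in>set [0..<3]. a \<noteq> b \<longrightarrow> (\<forall>P\<in>set [0..<4]. \<forall>Q\<in>set [0..<4].
     length (filter (\<lambda>j. centre_row a j = P \<and> centre_row b j = Q) [0..<16]) = 1)"
    by code_simp
  then have "card {j. j < 16 \<and> centre_row a j = P \<and> centre_row b j = Q} = 1"
    using assms by (simp add: length_filter_upt)
  then show ?thesis
    by (rule card_1_ex1)
qed

text \<open>
  A leaf \<open>i\<close> in row \<open>i div 3\<close> lies outside the row \<open>P\<close> of the centres of its own layer, so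
  \<open>P - i div 3\<close> modulo \<open>4\<close> is one of \<open>1, 2, 3\<close>. Used as a rotation of the three positions of a row,
  it gives the position of the centre in the neighbouring layer. Without the inner reduction modulo
  \<open>4\<close> two different \<open>P\<close> would give the same rotation.
\<close>

definition slot :: "nat \<Rightarrow> nat \<Rightarrow> nat" where
  "slot P i = (i mod 3 + (P + 4 - i div 3) mod 4) mod 3"

text \<open>
  The rotation that takes \<open>i\<close> to \<open>q\<close> is determined modulo \<open>3\<close>, hence so is \<open>P - i div 3\<close> among
  \<open>1, 2, 3\<close>: this recovers the class of an edge.
\<close>

lemma slot_solve:
  assumes "i < 12" "q < 3"
  shows "\<exists>!P. P < 4 \<and> P \<noteq> i div 3 \<and> slot P i = q"
proof -
  have "\<forall>i\<in>set [0..<12]. \<forall>q\<in>set [0..<3].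
     length (filter (\<lambda>P. P \<noteq> i div 3 \<and> slot P i = q) [0..<4]) = 1"
    by code_simp
  then have "card {P. P < 4 \<and> P \<noteq> i div 3 \<and> slot P i = q} = 1"
    using assms by (simp add: length_filter_upt)
  then show ?thesis
    by (rule card_1_ex1)
qed

text \<open>
  Each of the three rows other than \<open>P\<close> is rotated bijectively and so contributes one leaf to each
  centre: the stars have three leaves.
\<close>

lemma slot_fibre:
  assumes "P < 4" "q < 3"
  shows "card {i. i < 12 \<and> i div 3 \<noteq> P \<and> slot P i = q} = 3"
proof -
  have "\<forall>P\<in>set [0..<4]. \<forall>q\<in>set [0..<3].
     length (filter (\<lambda>i. i div 3 \<noteq> P \<and> slot P i = q) [0..<12]) = 3"
    by code_simp
  then show ?thesis
    using assms by (simp add: length_filter_upt)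
qed

section \<open>Sixteen star classes for a difference of layers\<close>

text \<open>
  The pair \<open>(x, i)\<close> is point \<open>i\<close> of layer \<open>x\<close>; the point \<open>i\<close> lies in row \<open>i div 3\<close> at position
  \<open>i mod 3\<close>.
\<close>

definition vertices :: "nat \<Rightarrow> (nat \<times> nat) set" where
  "vertices n = {..<n} \<times> {..<12}"

text \<open>
  A proper \<open>3\<close>-colouring of the cycles \<open>x \<mapsto> x + d\<close> of \<open>\<int>\<^sub>n\<close>: blocks of \<open>d\<close> consecutive layers
  alternate between \<open>0\<close> and \<open>1\<close>, and the last \<open>d\<close> layers, which are the ones that wrap around,
  get the third colour.
\<close>

definition colour :: "nat \<Rightarrow> nat \<Rightarrow> nat \<Rightarrow> nat" where
  "colour n d x = (if n - d \<le> x then 2 else x div d mod 2)"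

lemma colour_less: "colour n d x < 3"
proof -
  have "m mod 2 < 3" for m :: nat
    by (rule less_trans[OF mod_less_divisor]) simp_all
  then show ?thesis
    by (simp add: colour_def)
qed

lemma colour_proper:
  assumes "0 < d" "2 * d \<le> n" "x < n"
  shows "colour n d ((x + d) mod n) \<noteq> colour n d x"
proof (cases "x < n - d")
  case True
  then have "(x + d) mod n = x + d"
    by simp
  moreover have "(x + d) div d = Suc (x div d)"
    using assms(1) div_add_self2[of d x] by simp
  moreover have "Suc m mod 2 \<noteq> m mod 2" for m :: nat
    by presburger
  moreover have "m mod 2 \<noteq> 2" for m :: nat
    by presburger
  ultimately show ?thesis
    using True by (auto simp: colour_def)
next
  case False
  then have "(x + d) mod n = x + d - n"
    using assms by (simp add: mod_if)
  moreover have "x + d - n < d"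
    using assms by linarith
  ultimately show ?thesis
    using False assms by (simp add: colour_def)
qed

lemma centre_row_less: "j < 16 \<Longrightarrow> centre_row a j < 4"
  by (auto simp: centre_row_def)

lemma slot_less: "slot P i < 3"
  by (simp add: slot_def)

lemma row_slot_eq_iff:
  fixes q :: nat
  assumes "q < 3"
  shows "i = 3 * P + q \<longleftrightarrow> P = i div 3 \<and> q = i mod 3"
  using assms by auto

lemma shift_back:
  fixes x :: nat
  assumes "0 < d" "d < n" "x < n"
  shows "((x + d) mod n + n - d) mod n = x"
  using assms by (cases "x + d < n") (simp_all add: mod_if)

lemma shift_forth:
  fixes y :: nat
  assumes "0 < d" "d < n" "y < n"
  shows "((y + n - d) mod n + d) mod n = y"
proof (cases "y < d")
  case True
  then show ?thesis
    using assms by simp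
next
  case False
  then have "y + n - d = (y - d) + n"
    by simp
  then have "(y + n - d) mod n = y - d"
    using assms by (simp only: mod_add_self2) simp
  then show ?thesis
    using assms False by simp
qed

text \<open>
  In class \<open>j\<close> the centres in a layer of colour \<open>a\<close> are the points of row \<open>centre_row a j\<close>, and
  their leaves are the other nine points, all in the next layer \<open>x + d\<close>. With the same centre row in
  both layers no class would use the edges inside that row; proper colouring prevents this.
\<close>

definition lab_step :: "nat \<Rightarrow> nat \<Rightarrow> nat \<Rightarrow> nat \<times> nat \<Rightarrow> nat \<times> nat" where
  "lab_step n d j = (\<lambda>(y, i).
     let x = (y + n - d) mod n; P = centre_row (colour n d y) j
     in if i div 3 = P then (y, i) else (x, 3 * centre_row (colour n d x) j + slot P i))"

lemma lab_step_eq_iff: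
  assumes "0 < d" "2 * d \<le> n" "x < n"
  shows "lab_step n d j ((x + d) mod n, i') = (x, i) \<longleftrightarrow>
     i' div 3 \<noteq> centre_row (colour n d ((x + d) mod n)) j \<and>
     i div 3 = centre_row (colour n d x) j \<and>
     slot (centre_row (colour n d ((x + d) mod n)) j) i' = i mod 3"
proof -
  have "(x + d) mod n \<noteq> x"
    using assms colour_proper[OF assms] by auto
  moreover have "((x + d) mod n + n - d) mod n = x"
    using assms by (intro shift_back) auto
  moreover have "3 * P + slot Q i' = i \<longleftrightarrow> i div 3 = P \<and> slot Q i' = i mod 3" for P Q
    using row_slot_eq_iff[OF slot_less[of Q i'], of i P] by metis
  ultimately show ?thesis
    by (auto simp: lab_step_def Let_def)
qed

text \<open>
  From the two end points, the row \<open>P\<close> of the centres in the later layer is recovered by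
  \<open>slot_solve\<close>; the centre row in the earlier layer is the row of \<open>i\<close>. By orthogonality these two rows
  determine the class. The edge cannot also be used in the opposite direction, because
  \<open>2 * d < n\<close>.
\<close>

lemma lab_step_once:
  assumes "0 < d" "2 * d < n" "x < n" "i < 12" "i' < 12"
  shows "\<exists>!j. j < 16 \<and> adj True (lab_step n d j) (x, i) ((x + d) mod n, i')"
proof -
  let ?y = "(x + d) mod n"
  let ?a = "colour n d x" and ?b = "colour n d ?y"
  have bwd: "fst (lab_step n d j (x, i)) \<noteq> ?y" for j
  proof
    assume eq: "fst (lab_step n d j (x, i)) = ?y"
    have "?y \<noteq> x"
      using colour_proper[of d n x] assms by auto
    then have "(x + n - d) mod n = ?y"
      using eq by (auto simp: lab_step_def Let_def split: if_splits)
    then have "(?y + d) mod n = x"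
      using shift_forth[of d n x] assms by simp
    then have "(x + 2 * d) mod n = x"
      by (simp add: mod_add_left_eq mult_2 flip: add.assoc)
    then show False
      using assms mod_if[of "x + 2 * d - n" n] le_mod_geq[of n "x + 2 * d"]
      by (cases "x + 2 * d < n") auto
  qed
  have adj: "adj True (lab_step n d j) (x, i) (?y, i') \<longleftrightarrow>
      i' div 3 \<noteq> centre_row ?b j \<and> i div 3 = centre_row ?a j \<and> slot (centre_row ?b j) i' = i mod 3" for j
    using bwd[of j] lab_step_eq_iff[of d n x j i' i] assms by (auto simp: adj_def)
  have "\<exists>!P. P < 4 \<and> P \<noteq> i' div 3 \<and> slot P i' = i mod 3"
    using assms by (intro slot_solve) auto
  then obtain P where P: "P < 4 \<and> P \<noteq> i' div 3 \<and> slot P i' = i mod 3"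
    and P_unique: "\<forall>P'. P' < 4 \<and> P' \<noteq> i' div 3 \<and> slot P' i' = i mod 3 \<longrightarrow> P' = P"
    by (rule ex1E)
  have "\<exists>!j. j < 16 \<and> centre_row ?a j = i div 3 \<and> centre_row ?b j = P"
    using assms P colour_proper[of d n x] by (intro centre_row_orthogonal colour_less) auto
  moreover have "adj True (lab_step n d j) (x, i) (?y, i') \<longleftrightarrow>
      centre_row ?a j = i div 3 \<and> centre_row ?b j = P" if "j < 16" for j
    unfolding adj using P P_unique centre_row_less[OF that] by metis
  ultimately show ?thesis
    by (metis (no_types, lifting))
qed

lemma lab_step_in:
  assumes "0 < d" "2 * d < n" "j < 16" "p \<in> vertices n"
  shows "\<exists>x q. x < n \<and> q < 3 \<and> lab_step n d j p = (x, 3 * centre_row (colour n d x) j + q)"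
proof -
  obtain y i where p: "p = (y, i)" "y < n"
    using assms by (auto simp: vertices_def)
  show ?thesis
  proof (cases "i div 3 = centre_row (colour n d y) j")
    case True
    then have "lab_step n d j p = (y, 3 * centre_row (colour n d y) j + i mod 3)"
      by (simp add: p lab_step_def flip: True)
    then show ?thesis
      using p by (intro exI[of _ y] exI[of _ "i mod 3"]) simp
  next
    case False
    have "(y + n - d) mod n < n"
      using p by simp
    with False show ?thesis
      unfolding p(1) lab_step_def Let_def using slot_less by (simp del: mod_less) blast
  qed
qed

lemma labelling_lab_step:
  assumes "0 < d" "2 * d < n" "j < 16"
  shows "labelling True (vertices n) (lab_step n d j)"
  unfolding labelling_def
proof
  let ?f = "lab_step n d j"
  fix p assume "p \<in> vertices n"
  then obtain x q where x: "x < n" and q: "q < 3"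
    and fp: "?f p = (x, 3 * centre_row (colour n d x) j + q)"
    using lab_step_in[OF assms] by blast
  let ?y = "(x + d) mod n"
  let ?c = "(x, 3 * centre_row (colour n d x) j + q)"
  let ?P = "centre_row (colour n d ?y) j"
  let ?L = "{i. i < 12 \<and> i div 3 \<noteq> ?P \<and> slot ?P i = q}"
  have PA: "centre_row (colour n d x) j < 4" and PB: "?P < 4"
    using assms(3) by (auto intro: centre_row_less)
  have c: "?c \<in> vertices n"
    using x q PA by (simp add: vertices_def)
  have fc: "?f ?c = ?c"
    using q by (simp add: lab_step_def)
  have yx: "?y \<noteq> x"
    using colour_proper[of d n x] assms x by auto
  have leaf: "?f (?y, i) = ?c \<longleftrightarrow> i div 3 \<noteq> ?P \<and> slot ?P i = q" for i
    using lab_step_eq_iff[of d n x j i] assms x q by auto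
  have other: "y = ?y \<or> (y, i) = ?c" if "?f (y, i) = ?c" "y < n" for y i
    using that shift_forth[of d n y] assms
    by (auto simp: lab_step_def Let_def split: if_splits)
  have "fibre (vertices n) ?f ?c = insert ?c (Pair ?y ` ?L)"
  proof
    show "insert ?c (Pair ?y ` ?L) \<subseteq> fibre (vertices n) ?f ?c"
      using c fc leaf x by (auto simp: fibre_def vertices_def)
    show "fibre (vertices n) ?f ?c \<subseteq> insert ?c (Pair ?y ` ?L)"
    proof
      fix r assume r: "r \<in> fibre (vertices n) ?f ?c"
      then obtain y i where yi: "r = (y, i)" "y < n" "i < 12" "?f (y, i) = ?c"
        by (auto simp: fibre_def vertices_def)
      then consider "y = ?y" | "(y, i) = ?c"
        using other by blast
      then show "r \<in> insert ?c (Pair ?y ` ?L)"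
      proof cases
        case 1
        then show ?thesis
          using yi leaf[of i] by blast
      next
        case 2
        then show ?thesis
          using yi by blast
      qed
    qed
  qed
  moreover have "?c \<notin> Pair ?y ` ?L"
    using yx by auto
  moreover have "card (Pair ?y ` ?L) = 3"
    using slot_fibre[OF PB q] by (simp add: card_image inj_on_def)
  moreover have "finite ?L"
    by simp
  ultimately show "?f p \<in> vertices n \<and> (True \<longrightarrow> ?f (?f p) = ?f p) \<and>
      card (fibre (vertices n) ?f (?f p)) = (if True then 4 else 3)"
    using c fc by (simp add: fp)
qed

section \<open>The middle difference\<close>

text \<open>
  When \<open>n = 2 * d\<close>, the layers \<open>y\<close> and \<open>y + d\<close> are paired; \<open>decode d y\<close> places the \<open>24\<close> points
  of the bipartite graph on this pair, the sides being given by the parity of \<open>w div 3\<close>.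
\<close>

definition encode :: "nat \<Rightarrow> nat \<times> nat \<Rightarrow> nat" where
  "encode d = (\<lambda>(x, i). 6 * (i div 3) + (if x < d then 0 else 3) + i mod 3)"

definition decode :: "nat \<Rightarrow> nat \<Rightarrow> nat \<Rightarrow> nat \<times> nat" where
  "decode d y w = (y + (if even (w div 3) then 0 else d), 3 * (w div 6) + w mod 3)"

definition lab_half :: "nat \<Rightarrow> nat \<Rightarrow> nat \<times> nat \<Rightarrow> nat \<times> nat" where
  "lab_half d j p = decode d (fst p mod d) (lab24 j (encode d p))"

lemma encode_decode:
  assumes "y < d"
  shows "encode d (decode d y w) = w"
proof -
  have 1: "w div 6 = w div 3 div 2"
    by (simp flip: div_mult2_eq)
  have 2: "(3 * a + w mod 3) div 3 = a" for a
    by simp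
  have 3: "3 * (w div 3) + w mod 3 = w"
    by simp
  have "6 * (w div 6) + (if even (w div 3) then 0 else 3) + w mod 3 = w"
  proof (cases "even (w div 3)")
    case True
    then have "2 * (w div 3 div 2) = w div 3"
      by simp
    then have "6 * (w div 6) = 3 * (w div 3)"
      using 1 by linarith
    then have "6 * (w div 6) + w mod 3 = w"
      using 3 by linarith
    then show ?thesis
      by (simp only: True if_True add_0_right)
  next
    case False
    then have "2 * (w div 3 div 2) + 1 = w div 3"
      by (rule odd_two_times_div_two_succ)
    then have "6 * (w div 6) + 3 + w mod 3 = w"
      using 1 3 by linarith
    then show ?thesis
      by (simp only: False if_False)
  qed
  then show ?thesis
    using assms by (simp add: encode_def decode_def 2 split: if_splits)
qed

lemma fst_decode: "y < d \<Longrightarrow> fst (decode d y w) mod d = y"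
  by (simp add: decode_def)

lemma decode_encode:
  assumes "x < 2 * d" "i < 12"
  shows "decode d (x mod d) (encode d (x, i)) = (x, i)"
proof -
  have aux: "(6 * a + 3 * b + q) div 3 = 2 * a + b" "(6 * a + 3 * b + q) div 6 = a"
      "(6 * a + 3 * b + q) mod 3 = q" if "b < 2" "q < 3" for a b q :: nat
  proof -
    show "(6 * a + 3 * b + q) div 3 = 2 * a + b"
      using that by (intro div_nat_eqI) auto
    show "(6 * a + 3 * b + q) div 6 = a"
      using that by (intro div_nat_eqI) auto
    have "6 * a + 3 * b + q = q + 3 * (2 * a + b)"
      by simp
    then show "(6 * a + 3 * b + q) mod 3 = q"
      using that by (simp only: mod_mult_self2 mod_less)
  qed
  have 1: "even ((6 * (i div 3) + i mod 3) div 3)" "(6 * (i div 3) + i mod 3) div 6 = i div 3"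
      "odd ((6 * (i div 3) + 3 + i mod 3) div 3)" "(6 * (i div 3) + 3 + i mod 3) div 6 = i div 3"
      "(6 * (i div 3) + 3 + i mod 3) mod 3 = i mod 3" "(6 * (i div 3) + i mod 3) mod 3 = i mod 3"
    using aux[of 0 "i mod 3" "i div 3"] aux[of 1 "i mod 3" "i div 3"]
    by (simp_all add: less_trans[OF mod_less_divisor])
  have 2: "x mod d + d = x" if "\<not> x < d"
  proof -
    have "x - d < d" "d \<le> x"
      using that assms by linarith+
    then show ?thesis
      by (simp add: le_mod_geq)
  qed
  show ?thesis
    using 1 2 by (cases "x < d") (simp_all add: encode_def decode_def)
qed

lemma encode_less: "i < 12 \<Longrightarrow> encode d (x, i) < 24"
  using mod_less_divisor[of 3 i] less_mult_imp_div_less[of i 4 3] by (auto simp: encode_def)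

lemma decode_in: "y < d \<Longrightarrow> w < 24 \<Longrightarrow> decode d y w \<in> vertices (2 * d)"
  unfolding decode_def vertices_def
  using mod_less_divisor[of 3 w] less_mult_imp_div_less[of w 4 6] by auto

lemma vertices_decode:
  assumes "p \<in> vertices (2 * d)"
  obtains y w where "y < d" "w < 24" "p = decode d y w"
proof -
  obtain x i where "p = (x, i)" "x < 2 * d" "i < 12"
    using assms by (auto simp: vertices_def)
  then show ?thesis
    using decode_encode[of x d i] encode_less[of i d x]
    by (intro that[of "x mod d" "encode d p"]) auto
qed

lemma decode_eq_iff:
  assumes "y < d" "w < 24" "y' < d" "w' < 24"
  shows "decode d y w = decode d y' w' \<longleftrightarrow> y = y' \<and> w = w'"
  using assms encode_decode fst_decode by metis

lemma lab_half_decode: "y < d \<Longrightarrow> w < 24 \<Longrightarrow> lab_half d j (decode d y w) = decode d y (lab24 j w)"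
  by (simp add: lab_half_def encode_decode fst_decode)

lemma labelling_lab_half:
  assumes "j < 8"
  shows "labelling True (vertices (2 * d)) (lab_half d j)"
  unfolding labelling_def
proof
  let ?f = "lab_half d j" and ?V = "vertices (2 * d)"
  fix p assume "p \<in> ?V"
  then obtain y w where yw: "y < d" "w < 24" "p = decode d y w"
    by (rule vertices_decode)
  have fp: "?f p = decode d y (lab24 j w)"
    using yw by (simp add: lab_half_decode)
  have "fibre ?V ?f (?f p) = decode d y ` {w'. w' < 24 \<and> lab24 j w' = lab24 j w}" (is "_ = _ ` ?S")
  proof
    show "decode d y ` ?S \<subseteq> fibre ?V ?f (?f p)"
      using yw decode_in by (auto simp: fibre_def fp lab_half_decode)
    show "fibre ?V ?f (?f p) \<subseteq> decode d y ` ?S"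
    proof
      fix r assume r: "r \<in> fibre ?V ?f (?f p)"
      then obtain y' w' where r': "y' < d" "w' < 24" "r = decode d y' w'"
        using vertices_decode by (metis (no_types, lifting) fibre_def mem_Collect_eq)
      have "decode d y' (lab24 j w') = decode d y (lab24 j w)"
        using r r' by (simp add: fibre_def fp lab_half_decode)
      then have "y' = y" "lab24 j w' = lab24 j w"
        using decode_eq_iff r' yw lab24_fibre(1) assms by blast+
      then show "r \<in> decode d y ` ?S"
        using r' by blast
    qed
  qed
  moreover have "inj_on (decode d y) ?S"
    using yw decode_eq_iff by (auto simp: inj_on_def)
  ultimately have "card (fibre ?V ?f (?f p)) = 4"
    using lab24_fibre(3)[OF assms yw(2)] by (simp add: card_image)
  then show "?f p \<in> ?V \<and> (True \<longrightarrow> ?f (?f p) = ?f p) \<and>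
      card (fibre ?V ?f (?f p)) = (if True then 4 else 3)"
    using lab24_fibre(1,2)[OF assms yw(2)] yw(1) decode_in by (simp add: fp lab_half_decode)
qed

lemma adj_lab_half:
  assumes "j < 8" "y < d" "y' < d" "w < 24" "w' < 24"
  shows "adj True (lab_half d j) (decode d y w) (decode d y' w') \<longleftrightarrow>
    y = y' \<and> adj True (lab24 j) w w'"
  using assms lab24_fibre(1)[OF assms(1)]
  by (auto simp: adj_def lab_half_decode decode_eq_iff)

lemma lab_half_once:
  assumes "x < d" "i < 12" "i' < 12"
  shows "\<exists>!j. j < 8 \<and> adj True (lab_half d j) (x, i) (x + d, i')"
proof -
  define w where "w = encode d (x, i)"
  define w' where "w' = encode d (x + d, i')"
  have w: "w < 24" "(x, i) = decode d x w"
    using decode_encode[of x d i] encode_less[of i d x] assms by (auto simp: w_def)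
  have w': "w' < 24" "(x + d, i') = decode d x w'"
    using decode_encode[of "x + d" d i'] encode_less[of i' d "x + d"] assms by (auto simp: w'_def)
  have par: "even (w div 3)" "odd (w' div 3)"
    using w(2) w'(2) assms by (auto simp: decode_def split: if_splits)
  then have "card {j. j < 8 \<and> adj True (lab24 j) w w'} = 1"
    using lab24_once[OF w(1) w'(1)] by auto
  then have "\<exists>!j. j < 8 \<and> adj True (lab24 j) w w'"
    by (rule card_1_ex1)
  moreover have "adj True (lab_half d j) (x, i) (x + d, i') \<longleftrightarrow> adj True (lab24 j) w w'" if "j < 8" for j
    unfolding w(2) w'(2) using adj_lab_half[OF that] assms(1) w w' by blast
  ultimately show ?thesis
    by (metis (no_types, lifting))
qed

lemma lab_half_offset:
  assumes "j < 8" "p \<in> vertices (2 * d)" "q \<in> vertices (2 * d)" "p \<noteq> q" "adj True (lab_half d j) p q"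
  shows "fst q = fst p + d \<or> fst p = fst q + d"
proof -
  obtain y w where p: "y < d" "w < 24" "p = decode d y w"
    using assms(2) by (rule vertices_decode)
  obtain y' w' where q: "y' < d" "w' < 24" "q = decode d y' w'"
    using assms(3) by (rule vertices_decode)
  have *: "y = y'" "adj True (lab24 j) w w'"
    using assms p q by (simp_all add: adj_lab_half)
  then have "w \<noteq> w'"
    using assms(4) p q by auto
  have "{j. j < 8 \<and> adj True (lab24 j) w w'} \<noteq> {}"
    using * assms(1) by blast
  then have "card {j. j < 8 \<and> adj True (lab24 j) w w'} \<noteq> 0"
    by simp
  then have "even (w div 3) \<noteq> even (w' div 3)"
    using lab24_once[OF p(2) q(2) \<open>w \<noteq> w'\<close>] by (auto split: if_splits)
  then show ?thesis
    using p q * by (auto simp: decode_def)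
qed

section \<open>All classes together\<close>

text \<open>
  Class \<open>(d, j)\<close> uses edges between layers at cyclic distance \<open>d\<close>; distance \<open>0\<close> means inside a
  layer.
\<close>

definition lab :: "nat \<Rightarrow> nat \<times> nat \<Rightarrow> nat \<times> nat \<Rightarrow> nat \<times> nat" where
  "lab n = (\<lambda>(d, j). if d = 0 then (\<lambda>(x, i). (x, lab12 j i))
     else if 2 * d = n then lab_half d j else lab_step n d j)"

definition num_classes :: "nat \<Rightarrow> nat \<Rightarrow> nat" where
  "num_classes n d = (if d = 0 then 4 else if 2 * d = n then 8 else 16)"

definition star_classes :: "nat \<Rightarrow> (nat \<times> nat) set" where
  "star_classes n = (SIGMA d:{..n div 2}. {..<num_classes n d})"

definition cycle_classes :: "(nat \<times> nat) set" where
  "cycle_classes = {(0, 4), (0, 5)}"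

text \<open>
  For \<open>n = 2 * m + 1\<close> the count is \<open>4 + 16 * m\<close>, for \<open>n = 2 * m\<close> it is
  \<open>4 + 16 * (m - 1) + 8\<close>.
\<close>

lemma card_star_classes:
  assumes "0 < n"
  shows "card (star_classes n) = 8 * n - 4"
proof -
  have "card (star_classes n) = sum (num_classes n) {..n div 2}"
    by (simp add: star_classes_def card_SigmaI)
  also have "\<dots> = 8 * n - 4"
  proof (cases "even n")
    case True
    then obtain m where m: "n = 2 * m" by (elim evenE)
    have "{..n div 2} = insert 0 (insert m {1..<m})"
      using m by auto
    moreover have "sum (num_classes n) {1..<m} = sum (\<lambda>_. 16) {1..<m}"
      using m by (intro sum.cong) (auto simp: num_classes_def)
    ultimately show ?thesis
      using m assms by (simp add: num_classes_def)
  next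
    case False
    then obtain m where m: "n = 2 * m + 1" by (elim oddE)
    have "{..n div 2} = insert 0 {1..m}"
      using m by auto
    moreover have "sum (num_classes n) {1..m} = sum (\<lambda>_. 16) {1..m}"
      using m by (intro sum.cong) (auto simp: num_classes_def)
    ultimately show ?thesis
      using m by (simp add: num_classes_def)
  qed
  finally show ?thesis .
qed

lemma labelling_lab12:
  assumes "j < 6"
  shows "labelling (j < 4) (vertices n) (\<lambda>(x, i). (x, lab12 j i))"
  unfolding labelling_def
proof
  let ?f = "\<lambda>(x, i). (x :: nat, lab12 j i)"
  fix p assume "p \<in> vertices n"
  then obtain x i where p: "p = (x, i)" "x < n" "i < 12"
    by (auto simp: vertices_def)
  have "fibre (vertices n) ?f (?f p) = Pair x ` {i'. i' < 12 \<and> lab12 j i' = lab12 j i}"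
    using p by (auto simp: fibre_def vertices_def)
  then have "card (fibre (vertices n) ?f (?f p)) = (if j < 4 then 4 else 3)"
    using lab12_fibre(3)[OF assms p(3)] by (simp add: card_image inj_on_def)
  then show "?f p \<in> vertices n \<and> (j < 4 \<longrightarrow> ?f (?f p) = ?f p) \<and>
      card (fibre (vertices n) ?f (?f p)) = (if j < 4 then 4 else 3)"
    using lab12_fibre(1,2)[OF assms p(3)] p by (simp add: vertices_def)
qed

lemma class_cases:
  assumes "k \<in> star_classes n \<union> cycle_classes"
  obtains j where "k = (0, j)" "j < 6" "k \<in> star_classes n \<longleftrightarrow> j < 4"
  | d j where "k = (d, j)" "0 < d" "2 * d = n" "j < 8" "k \<in> star_classes n"
  | d j where "k = (d, j)" "0 < d" "2 * d < n" "j < 16" "k \<in> star_classes n"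
proof -
  obtain d j where k: "k = (d, j)" by fastforce
  have "2 * d \<le> n" if "d \<le> n div 2"
    using that by linarith
  then show ?thesis
    using assms k that
    by (cases "d = 0"; cases "2 * d = n")
       (fastforce simp: star_classes_def cycle_classes_def num_classes_def)+
qed

lemma labelling_lab:
  assumes "k \<in> star_classes n \<union> cycle_classes"
  shows "labelling (k \<in> star_classes n) (vertices n) (lab n k)"
  using assms
proof (cases rule: class_cases)
  case (1 j)
  then show ?thesis
    using labelling_lab12[of j n] by (simp add: lab_def)
next
  case (2 d j)
  then show ?thesis
    using labelling_lab_half[of j d] by (simp add: lab_def)
next
  case (3 d j)
  then show ?thesis
    using labelling_lab_step[of d n j] by (simp add: lab_def)
qed

lemma adj_lab_step_offset:
  assumes "0 < d" "2 * d < n" "x < n" "y < n" "(x, i) \<noteq> (y, i')"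
    and "adj True (lab_step n d j) (x, i) (y, i')"
  shows "y = (x + d) mod n \<or> x = (y + d) mod n"
proof -
  have "y = (x + n - d) mod n \<or> x = (y + n - d) mod n"
    using assms(5,6) by (auto simp: adj_def lab_step_def Let_def split: if_splits)
  then show ?thesis
    using shift_forth[of d n x] shift_forth[of d n y] assms by auto
qed

lemma adj_lab_offset:
  assumes k: "(d, j) \<in> star_classes n \<union> cycle_classes"
    and xy: "x < n" "y < n" "i < 12" "i' < 12" "(x, i) \<noteq> (y, i')"
    and adj: "adj ((d, j) \<in> star_classes n) (lab n (d, j)) (x, i) (y, i')"
  shows "2 * d \<le> n \<and> (y = (x + d) mod n \<or> x = (y + d) mod n)"
  using k
proof (cases rule: class_cases)
  case (1 j)
  then show ?thesis
    using adj xy by (auto simp: adj_def lab_def split: if_splits)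
next
  case (2 d j)
  then have "y = x + d \<or> x = y + d"
    using adj xy lab_half_offset[of j "(x, i)" d "(y, i')"] by (auto simp: lab_def vertices_def)
  then show ?thesis
    using xy 2 by auto
next
  case (3 d j)
  then show ?thesis
    using adj xy adj_lab_step_offset[of d n x y i i' j] by (auto simp: lab_def)
qed

lemma offset_unique:
  fixes x y :: nat
  assumes "x < n" "y < n" "2 * d \<le> n" "2 * e \<le> n"
    and "y = (x + d) mod n \<or> x = (y + d) mod n"
    and "y = (x + e) mod n \<or> x = (y + e) mod n"
  shows "d = e"
proof -
  have *: "v = u + d \<or> v + n = u + d" if "u < n" "2 * d \<le> n" "v = (u + d) mod n" for u v d :: nat
    using that by (cases "u + d < n") (auto simp: le_mod_geq)
  show ?thesis
    using *[OF assms(1,3), of y] *[OF assms(2,3), of x] *[OF assms(1,4), of y] *[OF assms(2,4), of x]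
      assms by linarith
qed

lemma offset_exists:
  fixes x y :: nat
  assumes "x < n" "y < n" "x \<noteq> y"
  shows "\<exists>d. 0 < d \<and> 2 * d \<le> n \<and> (y = (x + d) mod n \<or> x = (y + d) mod n)"
proof -
  have "\<exists>d. 0 < d \<and> 2 * d \<le> n \<and> (v = (u + d) mod n \<or> u = (v + d) mod n)"
    if "u < v" "v < n" for u v :: nat
  proof (cases "2 * (v - u) \<le> n")
    case True
    then show ?thesis
      using that by (intro exI[of _ "v - u"]) auto
  next
    case False
    then show ?thesis
      using that by (intro exI[of _ "n - (v - u)"]) auto
  qed
  then show ?thesis
    using assms by (metis nat_neq_iff)
qed

lemma lab_once_forward:
  assumes "x < n" "i < 12" "i' < 12" "0 < d" "2 * d \<le> n" "y = (x + d) mod n"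
  shows "\<exists>!j. j < num_classes n d \<and> adj True (lab n (d, j)) (x, i) (y, i')"
proof (cases "2 * d = n")
  case False
  then show ?thesis
    using lab_step_once[of d n x i i'] assms by (simp add: lab_def num_classes_def)
next
  case True
  show ?thesis
  proof (cases "x < d")
    case lt: True
    then have "y = x + d"
      using True assms by simp
    then show ?thesis
      using lab_half_once[OF lt assms(2,3)] True assms by (simp add: lab_def num_classes_def)
  next
    case False
    then have "x = y + d" "y < d"
      using True assms by (auto simp: le_mod_geq)
    then show ?thesis
      using lab_half_once[of y d i' i] True assms
      by (subst adj_sym) (simp add: lab_def num_classes_def)
  qed
qed

lemma lab_once:
  assumes p: "p \<in> vertices n" and q: "q \<in> vertices n" and "p \<noteq> q"
    and "\<not> (fst q = fst p \<and> snd q = (snd p + 6) mod 12)"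
  shows "\<exists>!k. k \<in> star_classes n \<union> cycle_classes \<and> adj (k \<in> star_classes n) (lab n k) p q"
proof -
  obtain x i y i' where pq: "p = (x, i)" "x < n" "i < 12" "q = (y, i')" "y < n" "i' < 12"
    using p q by (auto simp: vertices_def)
  have "\<exists>d m. 2 * d \<le> n \<and> (y = (x + d) mod n \<or> x = (y + d) mod n) \<and>
      (\<forall>j. (d, j) \<in> star_classes n \<union> cycle_classes \<longleftrightarrow> j < m) \<and>
      (\<exists>!j. j < m \<and> adj ((d, j) \<in> star_classes n) (lab n (d, j)) p q)"
  proof (cases "x = y")
    case True
    then have "i \<noteq> i'" "i' \<noteq> (i + 6) mod 12"
      using assms pq by auto
    then have "card {j. j < 6 \<and> adj (j < 4) (lab12 j) i i'} = 1"
      using lab12_once[of i i'] pq by simp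
    then have "\<exists>!j. j < 6 \<and> adj (j < 4) (lab12 j) i i'"
      by (rule card_1_ex1)
    moreover have "(0, j) \<in> star_classes n \<longleftrightarrow> j < 4" for j
      by (simp add: star_classes_def num_classes_def)
    moreover have "adj s (lab n (0, j)) p q \<longleftrightarrow> adj s (lab12 j) i i'" for s j
      using True pq by (simp add: adj_def lab_def)
    ultimately have "\<exists>!j. j < 6 \<and> adj ((0, j) \<in> star_classes n) (lab n (0, j)) p q"
      by simp
    moreover have "(0, j) \<in> star_classes n \<union> cycle_classes \<longleftrightarrow> j < 6" for j
      by (auto simp: star_classes_def num_classes_def cycle_classes_def)
    ultimately show ?thesis
      using True pq by (intro exI[of _ 0] exI[of _ 6]) auto
  next
    case False
    then obtain d where d: "0 < d" "2 * d \<le> n" "y = (x + d) mod n \<or> x = (y + d) mod n"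
      using offset_exists[of x n y] pq by blast
    then have "\<exists>!j. j < num_classes n d \<and> adj True (lab n (d, j)) p q"
      using lab_once_forward[of x n i i' d y] lab_once_forward[of y n i' i d x] pq
        adj_sym[of True _ p q] by auto
    moreover have star: "(d, j) \<in> star_classes n \<longleftrightarrow> j < num_classes n d" for j
      using d by (auto simp: star_classes_def)
    ultimately have "\<exists>!j. j < num_classes n d \<and> adj ((d, j) \<in> star_classes n) (lab n (d, j)) p q"
      by (simp add: star cong: conj_cong)
    moreover have "(d, j) \<in> star_classes n \<union> cycle_classes \<longleftrightarrow> j < num_classes n d" for j
      using star d by (auto simp: cycle_classes_def)
    ultimately show ?thesis
      using d by blast
  qed
  then obtain d m where d: "2 * d \<le> n" "y = (x + d) mod n \<or> x = (y + d) mod n"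
    and m: "\<And>j. (d, j) \<in> star_classes n \<union> cycle_classes \<longleftrightarrow> j < m"
    and ex: "\<exists>!j. j < m \<and> adj ((d, j) \<in> star_classes n) (lab n (d, j)) p q"
    by (elim exE conjE) simp
  from ex obtain j where j: "j < m \<and> adj ((d, j) \<in> star_classes n) (lab n (d, j)) p q"
    and j_unique: "\<forall>j'. j' < m \<and> adj ((d, j') \<in> star_classes n) (lab n (d, j')) p q \<longrightarrow> j' = j"
    by (rule ex1E)
  show ?thesis
  proof
    show "(d, j) \<in> star_classes n \<union> cycle_classes \<and> adj ((d, j) \<in> star_classes n) (lab n (d, j)) p q"
      using j m by blast
    fix k assume k: "k \<in> star_classes n \<union> cycle_classes \<and> adj (k \<in> star_classes n) (lab n k) p q"
    obtain e j' where e: "k = (e, j')" by fastforce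
    have "2 * e \<le> n \<and> (y = (x + e) mod n \<or> x = (y + e) mod n)"
      using adj_lab_offset[of e j' n x y i i'] k e pq \<open>p \<noteq> q\<close> by blast
    then have "e = d"
      using offset_unique[of x n y e d] d pq by blast
    then show "k = (d, j)"
      using k e m j_unique by blast
  qed
qed

lemma lab_never:
  assumes p: "p \<in> vertices n" and q: "q \<in> vertices n"
    and partner: "fst q = fst p" "snd q = (snd p + 6) mod 12"
    and k: "k \<in> star_classes n \<union> cycle_classes"
  shows "\<not> adj (k \<in> star_classes n) (lab n k) p q"
proof
  assume adj: "adj (k \<in> star_classes n) (lab n k) p q"
  obtain x i i' where pq: "p = (x, i)" "x < n" "i < 12" "q = (x, i')" "i' < 12" "i' = (i + 6) mod 12"
    using p q partner by (auto simp: vertices_def)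
  have "i \<noteq> i'"
    using pq by (cases "i < 6") (auto simp: le_mod_geq)
  obtain d j where dj: "k = (d, j)" by fastforce
  have "2 * d \<le> n \<and> (x = (x + d) mod n \<or> x = (x + d) mod n)"
    using adj_lab_offset[of d j n x x i i'] k dj adj pq \<open>i \<noteq> i'\<close> by blast
  then have "d = 0"
    using offset_unique[of x n x d 0] pq by simp
  then have *: "j < 6" "adj (j < 4) (lab12 j) i i'"
    using k dj adj pq
    by (auto simp: star_classes_def cycle_classes_def num_classes_def lab_def adj_def split: if_splits)
  have "card {j. j < 6 \<and> adj (j < 4) (lab12 j) i i'} = 0"
    using lab12_once[of i i'] pq \<open>i \<noteq> i'\<close> by simp
  then have "{j. j < 6 \<and> adj (j < 4) (lab12 j) i i'} = {}"
    by simp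
  with * show False
    by blast
qed

section \<open>Coordinates adapted to the one-factor\<close>

lemma labelling_transport:
  assumes h: "bij_betw h W V" and f: "labelling s W f"
  shows "labelling s V (\<lambda>v. h (f (inv_into W h v)))"
  unfolding labelling_def
proof
  let ?g = "inv_into W h"
  let ?f = "\<lambda>v. h (f (?g v))"
  fix v assume "v \<in> V"
  then obtain x where x: "x \<in> W" "v = h x"
    using h by (auto simp: bij_betw_def)
  have inj: "inj_on h W" and img: "h ` W = V"
    using h by (auto simp: bij_betw_def)
  have g: "?g (h y) = y" if "y \<in> W" for y
    using that inj by simp
  have fW: "f y \<in> W" if "y \<in> W" for y
    using f that by (simp add: labelling_def)
  have "fibre V ?f (?f v) = h ` fibre W f (f x)"
  proof -
    have "h (f y) = h (f x) \<longleftrightarrow> f y = f x" if "y \<in> W" for y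
      using that x fW inj by (simp add: inj_on_eq_iff)
    then show ?thesis
      using g x img unfolding fibre_def by (auto simp: image_iff)
  qed
  moreover have "inj_on h (fibre W f (f x))"
    using inj by (rule inj_on_subset) (auto simp: fibre_def)
  ultimately have "card (fibre V ?f (?f v)) = card (fibre W f (f x))"
    by (simp add: card_image)
  then show "?f v \<in> V \<and> (s \<longrightarrow> ?f (?f v) = ?f v) \<and> card (fibre V ?f (?f v)) = (if s then 4 else 3)"
    using f x g fW img by (auto simp: labelling_def)
qed

lemma adj_transport:
  assumes h: "bij_betw h W V" and f: "labelling s W f" and "x \<in> W" "y \<in> W"
  shows "adj s (\<lambda>v. h (f (inv_into W h v))) (h x) (h y) \<longleftrightarrow> adj s f x y"
proof -
  have "inj_on h W"
    using h by (simp add: bij_betw_def)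
  then show ?thesis
    using assms(2-4) by (simp add: adj_def labelling_def inj_on_eq_iff)
qed

text \<open>
  The \<open>6 * n\<close> edges of the one-factor are numbered and distributed to the layers, six to each. In
  layer \<open>x\<close> the two ends of its \<open>i\<close>-th edge become the points \<open>i\<close> and \<open>i + 6\<close>.
\<close>

lemma one_factor_coordinates:
  assumes fin: "finite V" and cardV: "card V = 12 * n" and I: "one_factor V (complete_edges V) I"
  shows "\<exists>h. bij_betw h (vertices n) V \<and>
    (\<forall>p\<in>vertices n. \<forall>q\<in>vertices n. p \<noteq> q \<longrightarrow>
       ({h p, h q} \<in> I \<longleftrightarrow> fst q = fst p \<and> snd q = (snd p + 6) mod 12))"
proof -
  have edge: "\<exists>a b. e = {a, b} \<and> a \<in> V \<and> b \<in> V \<and> a \<noteq> b" if "e \<in> I" for e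
    using that I unfolding one_factor_def complete_edges_def by blast
  then obtain a b where ab: "\<And>e. e \<in> I \<Longrightarrow> e = {a e, b e} \<and> a e \<in> V \<and> b e \<in> V \<and> a e \<noteq> b e"
    by metis
  have same_edge: "e = e'" if "e \<in> I" "e' \<in> I" "x \<in> e" "x \<in> e'" for e e' x
  proof -
    have "x \<in> V"
      using edge[OF that(1)] that(3) by auto
    then show ?thesis
      using I that unfolding one_factor_def by blast
  qed
  have UI: "\<Union>I = V"
    using edge I unfolding one_factor_def by blast
  have finI: "finite I"
    using UI fin finite_UnionD by auto
  have "card V = sum card I"
    unfolding UI[symmetric] using same_edge edge
    by (intro card_Union_disjoint) (auto simp: pairwise_def disjnt_iff)
  also have "\<dots> = 2 * card I"
  proof -
    have "card e = 2" if "e \<in> I" for e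
      using edge[OF that] by auto
    then show ?thesis by simp
  qed
  finally have "card I = 6 * n"
    using cardV by simp
  then obtain e where e: "bij_betw e {0..<6 * n} I"
    using ex_bij_betw_nat_finite[OF finI] by auto
  define idx where "idx p = 6 * fst p + snd p mod 6" for p :: "nat \<times> nat"
  define h where "h p = (if snd p < 6 then a (e (idx p)) else b (e (idx p)))" for p
  have idx_less: "idx p < 6 * n" if p: "p \<in> vertices n" for p
  proof -
    obtain x i where "p = (x, i)" "x < n"
      using p by (auto simp: vertices_def)
    moreover have "i mod 6 < 6"
      by simp
    ultimately have "6 * x + i mod 6 < 6 * n"
      by linarith
    then show ?thesis
      using \<open>p = (x, i)\<close> by (simp add: idx_def)
  qed
  then have eI: "e (idx p) \<in> I" if "p \<in> vertices n" for p
    using idx_less[OF that] e by (auto simp: bij_betw_def)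
  have h_mem: "h p \<in> e (idx p)" if "p \<in> vertices n" for p
    using ab[OF eI[OF that]] by (auto simp: h_def)
  have idx_eq: "fst p = fst q \<and> snd p mod 6 = snd q mod 6" if "idx p = idx q" for p q
  proof -
    have "idx r div 6 = fst r" "idx r mod 6 = snd r mod 6" for r
      by (simp_all add: idx_def)
    then show ?thesis
      using that by metis
  qed
  have e_eq: "fst p = fst q \<and> snd p mod 6 = snd q mod 6"
    if "p \<in> vertices n" "q \<in> vertices n" "e (idx p) = e (idx q)" for p q
  proof -
    have "inj_on e {0..<6 * n}"
      using e by (simp add: bij_betw_def)
    then have "idx p = idx q"
      using that(3) idx_less[OF that(1)] idx_less[OF that(2)] by (simp add: inj_on_eq_iff)
    then show ?thesis
      by (rule idx_eq)
  qed
  have mod6: "i mod 6 = (if i < 6 then i else i - 6)" if "i < 12" for i :: nat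
    using that by (simp add: le_mod_geq)
  have "inj_on h (vertices n)"
  proof (rule inj_onI)
    fix p q assume pq: "p \<in> vertices n" "q \<in> vertices n" "h p = h q"
    then have e_same: "e (idx p) = e (idx q)"
      using same_edge eI h_mem by metis
    then have eq: "fst p = fst q" "snd p mod 6 = snd q mod 6"
      using e_eq pq by blast+
    moreover have "snd p < 6 \<longleftrightarrow> snd q < 6"
      using pq(3) e_same ab[OF eI[OF pq(1)]] by (auto simp: h_def split: if_splits)
    ultimately show "p = q"
      using pq(1,2) mod6[of "snd p"] mod6[of "snd q"]
      by (auto simp: vertices_def split: if_splits)
  qed
  moreover have "h ` vertices n \<subseteq> V"
    using h_mem eI UI by blast
  moreover have "card (vertices n) = card V"
    by (simp add: vertices_def cardV)
  ultimately have bij: "bij_betw h (vertices n) V"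
    using fin by (simp add: bij_betw_def card_image card_subset_eq)
  have "{h p, h q} \<in> I \<longleftrightarrow> fst q = fst p \<and> snd q = (snd p + 6) mod 12"
    if pq: "p \<in> vertices n" "q \<in> vertices n" "p \<noteq> q" for p q
  proof
    assume "{h p, h q} \<in> I"
    then have "e (idx p) = e (idx q)"
      using same_edge eI[OF pq(1)] eI[OF pq(2)] h_mem[OF pq(1)] h_mem[OF pq(2)]
      by (metis insertI1 insertI2)
    then have "fst p = fst q" "snd p mod 6 = snd q mod 6"
      using e_eq pq by blast+
    then show "fst q = fst p \<and> snd q = (snd p + 6) mod 12"
      using pq mod6[of "snd p"] mod6[of "snd q"]
      by (auto simp: vertices_def le_mod_geq split: if_splits)
  next
    assume q: "fst q = fst p \<and> snd q = (snd p + 6) mod 12"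
    have "snd p < 12"
      using pq(1) by (auto simp: vertices_def)
    then have "snd q mod 6 = snd p mod 6" "snd q < 6 \<longleftrightarrow> \<not> snd p < 6"
      using q by (cases "snd p < 6"; simp add: le_mod_geq)+
    then have "idx q = idx p" "{h p, h q} = {a (e (idx p)), b (e (idx p))}"
      using q by (auto simp: idx_def h_def)
    then show "{h p, h q} \<in> I"
      using ab[OF eI[OF pq(1)]] eI[OF pq(1)] by metis
  qed
  with bij show ?thesis
    by blast
qed

theorem mainTheorem1:
  fixes V :: "'a set" and I :: "'a set set" and v :: nat
  assumes "v > 0" and "v mod 12 = 0"
    and "finite V" and "card V = v"
    and "one_factor V (complete_edges V) I"
  shows "\<exists>D. star_cycle_URD V (complete_edges V - I) (2 * (v - 6) div 3) 2 D"
proof -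
  obtain n where n: "v = 12 * n" "0 < n"
    using assms(1,2) by fastforce
  obtain h where h: "bij_betw h (vertices n) V"
    and partner: "\<And>p q. p \<in> vertices n \<Longrightarrow> q \<in> vertices n \<Longrightarrow> p \<noteq> q \<Longrightarrow>
       {h p, h q} \<in> I \<longleftrightarrow> fst q = fst p \<and> snd q = (snd p + 6) mod 12"
    using one_factor_coordinates[of V n I] assms n by auto
  let ?K = "star_classes n" and ?T = cycle_classes
  let ?lab = "\<lambda>k v. h (lab n k (inv_into (vertices n) h v))"
  have coord: "\<exists>p\<in>vertices n. x = h p" if "x \<in> V" for x
    using h that by (auto simp: bij_betw_def)
  have "\<exists>D. star_cycle_URD V (complete_edges V - I) (card ?K) (card ?T) D"
  proof (rule URD_from_labellings)
    show "finite ?K" "finite ?T" "?K \<inter> ?T = {}"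
      by (auto simp: star_classes_def cycle_classes_def num_classes_def)
    show "V \<noteq> {}"
      using assms by auto
    show "labelling (k \<in> ?K) V (?lab k)" if "k \<in> ?K \<union> ?T" for k
      using labelling_transport[OF h labelling_lab[OF that]] .
    show "\<exists>!k. k \<in> ?K \<union> ?T \<and> adj (k \<in> ?K) (?lab k) x y"
      if xy: "x \<in> V" "y \<in> V" "x \<noteq> y" "{x, y} \<notin> I" for x y
    proof -
      obtain p q where pq: "p \<in> vertices n" "q \<in> vertices n" "x = h p" "y = h q"
        using coord xy by metis
      then have "\<exists>!k. k \<in> ?K \<union> ?T \<and> adj (k \<in> ?K) (lab n k) p q"
        using xy partner[of p q] by (intro lab_once) auto
      moreover have "adj (k \<in> ?K) (?lab k) x y \<longleftrightarrow> adj (k \<in> ?K) (lab n k) p q" if "k \<in> ?K \<union> ?T" for k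
        using adj_transport[OF h labelling_lab[OF that] pq(1,2)] pq by simp
      ultimately show ?thesis
        by (simp cong: conj_cong)
    qed
    show "\<not> adj (k \<in> ?K) (?lab k) x y"
      if xy: "x \<in> V" "y \<in> V" "x \<noteq> y" "{x, y} \<in> I" "k \<in> ?K \<union> ?T" for x y k
    proof -
      obtain p q where pq: "p \<in> vertices n" "q \<in> vertices n" "x = h p" "y = h q"
        using coord xy by metis
      then have "\<not> adj (k \<in> ?K) (lab n k) p q"
        using xy partner[of p q] by (intro lab_never) auto
      then show ?thesis
        using adj_transport[OF h labelling_lab[OF xy(5)] pq(1,2)] pq by simp
    qed
  qed
  moreover have "card ?K = 2 * (v - 6) div 3"
  proof -
    have "2 * (v - 6) = 3 * (8 * n - 4)"
      using n by simp
    then show ?thesis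
      using card_star_classes[OF n(2)] by simp
  qed
  moreover have "card ?T = 2"
    by (simp add: cycle_classes_def)
  ultimately show ?thesis
    by simp
qed

end
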